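(* Let $k_0\in\mathbb{N}$ be an arbitrary fixed number, let $k\in\{1,\dots,k_0\}$, and let $\Omega$ (possibly depending on $T$) satisfy $0<\Omega=o\left(T\ln^{k-1}T\right)$ as $T\to\infty$. Then $$\int_{T^{(k)}}^{\left(T+\Omega\ln^{-k}T\right)^{(k)}}\prod_{r=0}^{k-1}\left|\zeta\left(\frac12+i\varphi_1^r(t)\right)\right|^2dt\sim\Omega,\qquad T\to\infty.$$
   Context: Let $Z(t)=e^{i\vartheta(t)}\zeta\left(\frac12+it\right)$ with $\vartheta(t)=-\frac t2\ln\pi+\operatorname{Im}\ln\Gamma\left(\frac14+i\frac t2\right)$, where $\zeta$ is the Riemann zeta-function. Jacob's ladder: $\varphi_1(t)=\frac12\varphi(t)$, where $y=\varphi(T)=\varphi_\mu(T)$ is the solution $x(T)$ of the nonlinear integral equation $$\int_0^{\mu[x(T)]}Z^2(t)e^{-\frac{2}{x(T)}t}\,dt=\int_0^T Z^2(t)\,dt,$$ generated by a fixed admissible function $\mu$, with $\mu(y)\ge 7y\ln y$. Known properties of $\varphi_1$ taken as standing facts: for large $t$ it is increasing, with $\varphi_1(t)\to\infty$ as $t\to\infty$; $T-\varphi_1(T)\sim(1-c)\pi(T)$ as $T\to\infty$, where $c$ is Euler's constant and $\pi$ is the prime-counting function, $\pi(T)\sim T/\ln T$; and $$\frac{d\varphi_1(t)}{dt}=\frac{\left|\zeta\left(\frac12+it\right)\right|^2}{\omega(t)},\qquad \omega(t)=\left\{1+O\left(\frac{\ln\ln t}{\ln t}\right)\right\}\ln t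 .$$ Iterations: $\varphi_1^0(t)=t$, $\varphi_1^1(t)=\varphi_1(t)$, $\varphi_1^2(t)=\varphi_1(\varphi_1(t))$, and so on. Reverse iterations: for large $X$ put $X^{(0)}=X$ and define $X^{(k)}$ by $\varphi_1(X^{(k)})=X^{(k-1)}$, $k=1,\dots,k_0$, i.e. $X^{(k)}=\varphi_1^{-k}(X)$. *)

theory Defs
  imports
    "HOL-Complex_Analysis.Complex_Analysis"
    "HOL-Computational_Algebra.Primes"
    "HOL-Library.Landau_Symbols"
begin

(* Analytic continuation of the Dirichlet series to the plane without the point 1;
   the value at the pole is set to 0 only to make the function unique. *)
definition riemann_zeta :: "complex \<Rightarrow> complex" where
  "riemann_zeta = (THE f. f holomorphic_on (- {1}) \<and>
     (\<forall>s. Re s > 1 \<longrightarrow> (\<lambda>n. 1 / of_nat (Suc n) powr s) sums f s) \<and> f 1 = 0)"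

definition zeta_crit :: "real \<Rightarrow> complex" where
  "zeta_crit t = riemann_zeta (1 / 2 + \<i> * of_real t)"

definition rs_theta :: "real \<Rightarrow> real" where
  "rs_theta t = - t / 2 * ln pi + Im (ln_Gamma (1 / 4 + \<i> * of_real (t / 2)))"

(* Z takes real values only; it is kept complex-valued so that the formula is the literal one. *)
definition hardy_Z :: "real \<Rightarrow> complex" where
  "hardy_Z t = exp (\<i> * of_real (rs_theta t)) * zeta_crit t"

definition admissible :: "(real \<Rightarrow> real) \<Rightarrow> bool" where
  "admissible \<mu> \<longleftrightarrow> (\<forall>\<^sub>F y in at_top. \<mu> y \<ge> 7 * y * ln y)"

definition solves_ladder_eq :: "(real \<Rightarrow> real) \<Rightarrow> (real \<Rightarrow> real) \<Rightarrow> bool" where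
  "solves_ladder_eq \<mu> \<phi> \<longleftrightarrow>
     (\<forall>\<^sub>F T in at_top. \<phi> T > 0 \<and>
        integral {0..\<mu> (\<phi> T)} (\<lambda>t. (hardy_Z t)\<^sup>2 * of_real (exp (- (2 / \<phi> T) * t)))
          = integral {0..T} (\<lambda>t. (hardy_Z t)\<^sup>2))"

definition ladder1 :: "(real \<Rightarrow> real) \<Rightarrow> real \<Rightarrow> real" where
  "ladder1 \<phi> t = \<phi> t / 2"

definition prime_counting :: "real \<Rightarrow> real" where
  "prime_counting x = real (card {p::nat. prime p \<and> real p \<le> x})"

(* The k-th reverse iteration of f. A ladder is only controlled for large arguments, so the
   inverse is that of the restriction of f to a half-line [T0, infinity) on which f is strictly
   increasing; for large X the result does not depend on T0. *)
definition reverse_iter :: "real \<Rightarrow> (real \<Rightarrow> real) \<Rightarrow> nat \<Rightarrow> real \<Rightarrow> real" where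
  "reverse_iter T0 f k X = (inv_into {T0..} f ^^ k) X"

end

(* Write f for the ladder and W(t) for the product of the omega (f^r t), r < k. By the chain rule the
   integrand is W times the derivative of f^k. Since T - f(T) = O(T / ln T), every iterate of f is
   asymptotic to the identity, so W(t) ~ ln^k (f^k t), and between the limits of integration f^k t lies
   between T and T + Omega / ln^k T, whose logarithms are asymptotically equal. Hence W is
   asymptotically the constant ln^k T there, while f^k increases by exactly Omega / ln^k T.
   Integrability of the integrand needs the continuity of zeta, because omega need not be measurable;
   so the definite description of zeta has to be shown to denote the analytic continuation. *)

theory Submission
  imports Defs
begin

section \<open>Analytic continuation of the zeta function\<close>

text \<open>Weierstrass M-test on closed discs, with a power of \<open>Suc n\<close> as majorant.
  Both \<open>C\<close> and \<open>p\<close> may depend on the disc, because no single exponent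
  above 1 need serve up to the boundary of the half-plane.\<close>

lemma holomorphic_on_suminf_powr_bound:
  fixes f :: "nat \<Rightarrow> complex \<Rightarrow> complex"
  assumes hol: "\<And>n. f n holomorphic_on {s. Re s > a}"
    and bound: "\<And>x r. 0 < r \<Longrightarrow> cball x r \<subseteq> {s. Re s > a} \<Longrightarrow>
      \<exists>C p. p > 1 \<and> (\<forall>n. \<forall>s\<in>cball x r. cmod (f n s) \<le> C * real (Suc n) powr (- p))"
  shows "(\<lambda>s. \<Sum>n. f n s) holomorphic_on {s. Re s > a}"
proof (rule holomorphic_uniform_sequence)
  show "open {s. Re s > a}" by (rule open_halfspace_Re_gt)
  show "(\<lambda>s. \<Sum>i<n. f i s) holomorphic_on {s. Re s > a}" for n
    by (intro holomorphic_intros hol)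
  fix x assume "x \<in> {s. Re s > a}"
  with open_halfspace_Re_gt[of a] obtain r where r: "r > 0" "cball x r \<subseteq> {s. Re s > a}"
    by (meson open_contains_cball)
  from bound[OF this] obtain C p where p: "p > 1"
    and C: "\<And>n s. s \<in> cball x r \<Longrightarrow> cmod (f n s) \<le> C * real (Suc n) powr (- p)" by blast
  have "summable (\<lambda>n. real n powr (- p))" using p by (simp add: summable_real_powr_iff)
  then have "summable (\<lambda>n. real (Suc n) powr (- p))" by (subst summable_Suc_iff)
  then have "summable (\<lambda>n. C * real (Suc n) powr (- p))" by (rule summable_mult)
  then have "uniform_limit (cball x r) (\<lambda>n s. \<Sum>i<n. f i s) (\<lambda>s. \<Sum>n. f n s) sequentially"
    by (rule Weierstrass_m_test[rotated]) (rule C)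
  with r show "\<exists>d>0. cball x d \<subseteq> {s. Re s > a} \<and>
      uniform_limit (cball x d) (\<lambda>n s. \<Sum>i<n. f i s) (\<lambda>s. \<Sum>n. f n s) sequentially" by blast
qed

lemma Re_ge_on_cball: "s \<in> cball x r \<Longrightarrow> Re x - r \<le> Re s"
  using abs_Re_le_cmod[of "x - s"] by (simp add: dist_norm)

text \<open>The leftmost point \<open>x - r\<close> of the closed disc still lies in the open
  half-plane; this strict margin later gives a summable exponent.\<close>

lemma cball_halfplane_Re_gt:
  assumes "0 < r" "cball x r \<subseteq> {s. Re s > a}"
  shows "Re x - r > a"
proof -
  have "x - of_real r \<in> cball x r" using assms(1) by (simp add: dist_norm)
  with assms(2) have "x - of_real r \<in> {s. Re s > a}" by (rule subsetD)
  then show ?thesis by simp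
qed

section \<open>The Dirichlet series in its half-plane of convergence\<close>

lemma norm_Suc_powr: "cmod (of_nat (Suc n) powr s) = real (Suc n) powr Re s"
  by (subst norm_powr_real_powr) simp_all

text \<open>To be read as zeta only for \<open>Re s > 1\<close>; elsewhere the series diverges and
  \<open>suminf\<close> has no meaningful value.\<close>

definition dirichlet_zeta :: "complex \<Rightarrow> complex" where
  "dirichlet_zeta s = (\<Sum>n. of_nat (Suc n) powr (- s))"

lemma dirichlet_zeta_sums:
  assumes "Re s > 1"
  shows "(\<lambda>n. of_nat (Suc n) powr (- s)) sums dirichlet_zeta s"
proof -
  have "summable (\<lambda>n. real n powr (- Re s))"
    using assms by (simp add: summable_real_powr_iff)
  then have "summable (\<lambda>n. cmod (of_nat (Suc n) powr (- s)))"
    unfolding norm_Suc_powr uminus_complex.sel by (subst summable_Suc_iff)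
  then have "summable (\<lambda>n. of_nat (Suc n) powr (- s))" by (rule summable_norm_cancel)
  then show ?thesis unfolding dirichlet_zeta_def by (rule summable_sums)
qed

lemma holomorphic_dirichlet_zeta: "dirichlet_zeta holomorphic_on {s. Re s > 1}"
  unfolding dirichlet_zeta_def[abs_def]
proof (rule holomorphic_on_suminf_powr_bound)
  show "(\<lambda>s. of_nat (Suc n) powr (- s)) holomorphic_on {s. Re s > 1}" for n
    by (intro holomorphic_intros)
  fix x :: complex and r :: real assume r: "0 < r" "cball x r \<subseteq> {s. Re s > 1}"
  define p where "p = Re x - r"
  have p: "p > 1" "\<And>s. s \<in> cball x r \<Longrightarrow> p \<le> Re s"
    unfolding p_def by (rule cball_halfplane_Re_gt[OF r]) (rule Re_ge_on_cball)
  have "cmod (of_nat (Suc n) powr (- s)) \<le> 1 * real (Suc n) powr (- p)" if "s \<in> cball x r" for n s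
    unfolding norm_Suc_powr mult_1 using p(2)[OF that] by (intro powr_mono) simp_all
  with p(1) show "\<exists>C p. p > 1 \<and>
     (\<forall>n. \<forall>s\<in>cball x r. cmod (of_nat (Suc n) powr (- s)) \<le> C * real (Suc n) powr (- p))"
    by (intro exI[of _ 1] exI[of _ p] conjI allI ballI)
qed

section \<open>Taylor expansion of complex powers\<close>

text \<open>The falling factorial of \<open>1 - s\<close>: the \<open>i\<close>-th derivative of
  \<open>x powr (1 - s)\<close> in \<open>x\<close> is
  \<open>falling i s * x powr (1 - s - of_nat i)\<close>.\<close>

definition falling :: "nat \<Rightarrow> complex \<Rightarrow> complex" where
  "falling i s = (\<Prod>l<i. 1 - s - of_nat l)"

lemma falling_simps [simp]:
  "falling 0 s = 1" "falling (Suc i) s = falling i s * (1 - s - of_nat i)"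
  by (simp_all add: falling_def)

lemma holomorphic_falling [holomorphic_intros]: "falling i holomorphic_on A"
  unfolding falling_def[abs_def] by (intro holomorphic_intros)

text \<open>The error at \<open>n + 2\<close> of the Taylor polynomial of degree \<open>K\<close> of
  \<open>x powr (1 - s)\<close> around \<open>n + 1\<close>. The increment is 1, so its powers do
  not appear.\<close>

definition powr_remainder :: "nat \<Rightarrow> nat \<Rightarrow> complex \<Rightarrow> complex" where
  "powr_remainder K n s = of_nat (Suc (Suc n)) powr (1 - s) -
     (\<Sum>i\<le>K. falling i s * of_nat (Suc n) powr (1 - s - of_nat i) / fact i)"

text \<open>Taylor's theorem on the segment from \<open>n + 1\<close> to \<open>n + 2\<close>. The
  assumption makes the modulus of the derivative of order \<open>K + 1\<close> nonincreasing along
  the segment, so its value at the left end is a bound.\<close>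

lemma norm_powr_remainder_le:
  assumes "Re s + real K \<ge> 0"
  shows "cmod (powr_remainder K n s) \<le>
    cmod (falling (Suc K) s) / fact K * real (Suc n) powr (- (Re s + real K))"
proof -
  define S where "S = closed_segment (of_nat (Suc n) :: complex) (of_nat (Suc (Suc n)))"
  define f where "f = (\<lambda>i x. falling i s * x powr (1 - s - of_nat i))"
  have S: "\<exists>t. x = of_real t \<and> real (Suc n) \<le> t" if "x \<in> S" for x
  proof -
    from that obtain u where u: "0 \<le> u" "u \<le> 1"
      "x = (1 - u) *\<^sub>R of_nat (Suc n) + u *\<^sub>R of_nat (Suc (Suc n))"
      unfolding S_def closed_segment_def by blast
    then have "x = of_real (real (Suc n) + u)" by (simp add: scaleR_conv_of_real algebra_simps)
    with u(1) show ?thesis by (intro exI[of _ "real (Suc n) + u"]) simp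
  qed
  have "cmod (f 0 (of_nat (Suc (Suc n))) -
     (\<Sum>i\<le>K. f i (of_nat (Suc n)) * (of_nat (Suc (Suc n)) - of_nat (Suc n)) ^ i / fact i))
     \<le> (cmod (falling (Suc K) s) * real (Suc n) powr (- (Re s + real K))) *
       cmod (of_nat (Suc (Suc n)) - of_nat (Suc n)) ^ Suc K / fact K"
  proof (rule complex_Taylor)
    show "convex S" by (simp add: S_def)
    show "of_nat (Suc n) \<in> S" "of_nat (Suc (Suc n)) \<in> S" by (simp_all add: S_def)
    fix x assume "x \<in> S"
    then obtain t where t: "x = of_real t" "real (Suc n) \<le> t" using S by blast
    have t0: "t > 0" using t(2) by simp
    \<comment> \<open>The segment avoids the branch cut of the complex power, so the derivative
      formula holds at each of its points.\<close>
    have "x \<notin> \<real>\<^sub>\<le>\<^sub>0" using t t0 by simp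
    then show "(f i has_field_derivative f (Suc i) x) (at x within S)" for i
      unfolding f_def by (auto intro!: derivative_eq_intros simp: algebra_simps)
    have "cmod (f (Suc K) x) = cmod (falling (Suc K) s) * t powr (- (Re s + real K))"
      using t0 by (simp add: f_def norm_mult t(1) norm_powr_real_powr algebra_simps del: falling_simps)
    also have "\<dots> \<le> cmod (falling (Suc K) s) * real (Suc n) powr (- (Re s + real K))"
      using assms t by (intro mult_left_mono powr_mono2') auto
    finally show "cmod (f (Suc K) x) \<le> \<dots>" .
  qed
  then show ?thesis by (simp add: f_def powr_remainder_def mult_ac del: falling_simps(2))
qed

text \<open>The remainders decay like \<open>real (Suc n) powr (- (Re s + real K))\<close>, which is
  summable for \<open>Re s > 1 - real K\<close>; on a closed disc, compactness bounds the factor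
  \<open>falling (Suc K) s\<close>.\<close>

lemma holomorphic_suminf_powr_remainder:
  "(\<lambda>s. \<Sum>n. powr_remainder K n s) holomorphic_on {s. Re s > 1 - real K}"
proof (rule holomorphic_on_suminf_powr_bound)
  show "powr_remainder K n holomorphic_on {s. Re s > 1 - real K}" for n
    unfolding powr_remainder_def[abs_def]
    by (intro holomorphic_intros) (auto simp del: of_nat_Suc)
  fix x :: complex and r :: real assume r: "0 < r" "cball x r \<subseteq> {s. Re s > 1 - real K}"
  define p where "p = Re x - r"
  have p: "p > 1 - real K" "\<And>s. s \<in> cball x r \<Longrightarrow> p \<le> Re s"
    unfolding p_def by (rule cball_halfplane_Re_gt[OF r]) (rule Re_ge_on_cball)
  have "compact (falling (Suc K) ` cball x r)"
    by (intro compact_continuous_image holomorphic_on_imp_continuous_on holomorphic_falling) auto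
  from compact_imp_bounded[OF this] obtain B where "\<forall>y\<in>falling (Suc K) ` cball x r. cmod y \<le> B"
    unfolding bounded_iff by (elim exE)
  then have B: "cmod (falling (Suc K) s) \<le> B" if "s \<in> cball x r" for s
    using that by (rule bspec[OF _ imageI])
  have "cmod (powr_remainder K n s) \<le> B / fact K * real (Suc n) powr (- (p + real K))"
    if s: "s \<in> cball x r" for n s
  proof -
    have "cmod (powr_remainder K n s) \<le>
        cmod (falling (Suc K) s) / fact K * real (Suc n) powr (- (Re s + real K))"
      using p(1) p(2)[OF s] by (intro norm_powr_remainder_le) auto
    also have "\<dots> \<le> B / fact K * real (Suc n) powr (- (p + real K))"
      using p(2)[OF s] B[OF s] order_trans[OF norm_ge_zero B[OF s]]
      by (intro mult_mono divide_right_mono powr_mono) auto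
    finally show ?thesis .
  qed
  with p(1) show "\<exists>C p. p > 1 \<and>
     (\<forall>n. \<forall>s\<in>cball x r. cmod (powr_remainder K n s) \<le> C * real (Suc n) powr (- p))"
    by (intro exI[of _ "B / fact K"] exI[of _ "p + real K"]) auto
qed

text \<open>Summing the Taylor expansions of \<open>x powr (1 - s)\<close> from \<open>n\<close> to \<open>n + 1\<close> telescopes on the left.
  The factor \<open>s - 1\<close> cancels the pole, and the shifted terms carry the matching factors
  \<open>s + j - 1\<close>, so that \<open>(s - 1) * zeta s\<close> is continued one unit to the left
  without any removable singularities.\<close>
lemma dirichlet_zeta_recursion:
  assumes "Re s > 1"
  shows "(s - 1) * dirichlet_zeta s = 1 + (\<Sum>n. powr_remainder (Suc m) n s) -
    (\<Sum>i<m. falling (Suc i) s / fact (Suc (Suc i)) * ((s + of_nat (Suc i) - 1) * dirichlet_zeta (s + of_nat (Suc i))))"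
    (is "_ = _ - ?S")
proof -
  have lim: "(\<lambda>n. of_nat (Suc n) powr (1 - s)) \<longlonglongrightarrow> (0::complex)"
  proof (rule tendsto_norm_zero_cancel)
    have "(\<lambda>n. real (Suc n) powr (1 - Re s)) \<longlonglongrightarrow> 0"
      using assms by (intro tendsto_neg_powr filterlim_compose[OF filterlim_real_sequentially filterlim_Suc]) auto
    then show "(\<lambda>n. cmod (of_nat (Suc n) powr (1 - s))) \<longlonglongrightarrow> 0"
      by (simp only: norm_Suc_powr) simp
  qed
  \<comment> \<open>The limit 0 comes from \<open>Re s > 1\<close>, and the first term is
    \<open>1 powr (1 - s) = 1\<close>; hence the total \<open>0 - 1\<close>.\<close>
  have tele: "(\<lambda>n. of_nat (Suc (Suc n)) powr (1 - s) - of_nat (Suc n) powr (1 - s)) sums (0 - 1 :: complex)"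
    using telescope_sums[OF lim] by simp
  \<comment> \<open>The exponent \<open>1 - s - (i + 1)\<close> equals \<open>- (s + i)\<close>, so
    the Taylor terms of degree \<open>i + 1\<close> sum over \<open>n\<close> to a shifted zeta
    value.\<close>
  have zeta: "(\<lambda>n. of_nat (Suc n) powr (1 - s - of_nat (Suc i))) sums dirichlet_zeta (s + of_nat i)" for i
    using dirichlet_zeta_sums[of "s + of_nat i"] assms by (simp add: algebra_simps)
  have "(\<lambda>n. of_nat (Suc (Suc n)) powr (1 - s) - of_nat (Suc n) powr (1 - s) -
      (\<Sum>i\<le>m. falling (Suc i) s / fact (Suc i) * of_nat (Suc n) powr (1 - s - of_nat (Suc i)))) sums
      (0 - 1 - (\<Sum>i\<le>m. falling (Suc i) s / fact (Suc i) * dirichlet_zeta (s + of_nat i)))"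
    by (intro sums_diff sums_sum sums_mult tele zeta)
  also have "(\<lambda>n. of_nat (Suc (Suc n)) powr (1 - s) - of_nat (Suc n) powr (1 - s) -
      (\<Sum>i\<le>m. falling (Suc i) s / fact (Suc i) * of_nat (Suc n) powr (1 - s - of_nat (Suc i)))) =
      (\<lambda>n. powr_remainder (Suc m) n s)"
    by (simp only: powr_remainder_def sum.atMost_Suc_shift falling_simps(1) of_nat_0 fact_0
        add_0_right diff_zero mult_1 div_by_1 times_divide_eq_left diff_diff_eq)
  finally have "(\<Sum>n. powr_remainder (Suc m) n s) =
      - 1 - (\<Sum>i\<le>m. falling (Suc i) s / fact (Suc i) * dirichlet_zeta (s + of_nat i))"
    by (simp add: sums_iff)
  also have "(\<Sum>i\<le>m. falling (Suc i) s / fact (Suc i) * dirichlet_zeta (s + of_nat i)) =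
     (1 - s) * dirichlet_zeta s + (\<Sum>i<m. falling (Suc (Suc i)) s / fact (Suc (Suc i)) * dirichlet_zeta (s + of_nat (Suc i)))"
    unfolding lessThan_Suc_atMost[symmetric] by (subst sum.lessThan_Suc_shift) simp
  also have "(\<Sum>i<m. falling (Suc (Suc i)) s / fact (Suc (Suc i)) * dirichlet_zeta (s + of_nat (Suc i))) =
    - (\<Sum>i<m. falling (Suc i) s / fact (Suc (Suc i)) * ((s + of_nat (Suc i) - 1) * dirichlet_zeta (s + of_nat (Suc i))))"
    unfolding sum_negf[symmetric]
  proof (rule sum.cong[OF refl])
    fix i
    \<comment> \<open>The last factor of \<open>falling (Suc (Suc i)) s\<close> is, up to sign, the
      one that cancels the pole of the shifted zeta function.\<close>
    have neg: "1 - s - of_nat (Suc i) = - (s + of_nat (Suc i) - 1)" by simp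
    show "falling (Suc (Suc i)) s / fact (Suc (Suc i)) * dirichlet_zeta (s + of_nat (Suc i)) =
      - (falling (Suc i) s / fact (Suc (Suc i)) * ((s + of_nat (Suc i) - 1) * dirichlet_zeta (s + of_nat (Suc i))))"
      by (simp only: falling_simps(2)[of "Suc i"] neg mult_minus_right mult_minus_left minus_divide_left[symmetric]
          times_divide_eq_left mult.assoc)
  qed
  finally have "(\<Sum>n. powr_remainder (Suc m) n s) = - 1 - ((1 - s) * dirichlet_zeta s + - ?S)" .
  moreover have "r = - 1 - ((1 - s) * d + - t) \<Longrightarrow> (s - 1) * d = 1 + r - t" for r d t :: complex
    by (simp add: algebra_simps)
  ultimately show ?thesis by blast
qed

section \<open>Continuation to the whole plane\<close>

text \<open>Induction through the recursion: its right-hand side evaluates zeta only at arguments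
  shifted by at least 1, where the previous continuation \<open>F\<close> is available, and its
  remainder series already converges on the larger half-plane.\<close>

lemma zeta_halfplane_continuation:
  "\<exists>F. F holomorphic_on {s. Re s > 1 - real m} \<and> (\<forall>s. Re s > 1 \<longrightarrow> F s = (s - 1) * dirichlet_zeta s)"
proof (induction m)
  case 0
  show ?case
    by (intro exI[of _ "\<lambda>s. (s - 1) * dirichlet_zeta s"])
       (auto intro!: holomorphic_intros holomorphic_dirichlet_zeta)
next
  case (Suc m)
  then obtain F where F: "F holomorphic_on {s. Re s > 1 - real m}"
    "\<And>s. Re s > 1 \<Longrightarrow> F s = (s - 1) * dirichlet_zeta s" by blast
  define G where "G = (\<lambda>s. 1 + (\<Sum>n. powr_remainder (Suc m) n s) -
    (\<Sum>i<m. falling (Suc i) s / fact (Suc (Suc i)) * F (s + of_nat (Suc i))))"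
  have shift: "(\<lambda>s. F (s + of_nat (Suc i))) holomorphic_on {s. Re s > 1 - real (Suc m)}" for i
    by (rule holomorphic_on_compose_gen[of "\<lambda>s. s + of_nat (Suc i)" _ F, OF _ F(1), unfolded o_def])
       (auto intro!: holomorphic_intros)
  have "G holomorphic_on {s. Re s > 1 - real (Suc m)}"
    unfolding G_def
    by (intro holomorphic_intros holomorphic_suminf_powr_remainder shift) auto
  moreover have "G s = (s - 1) * dirichlet_zeta s" if "Re s > 1" for s
    unfolding G_def dirichlet_zeta_recursion[OF that, of m] using that
    by (intro arg_cong2[where f = "(-)"] sum.cong refl arg_cong2[where f = "(*)"] F(2)) simp
  ultimately show ?case by blast
qed

text \<open>The half-planes are nested and exhaust the plane. By the identity theorem the
  continuations agree wherever two of them are defined, so they can be glued.\<close>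

lemma zeta_entire_continuation:
  "\<exists>F. F holomorphic_on UNIV \<and> (\<forall>s. Re s > 1 \<longrightarrow> F s = (s - 1) * dirichlet_zeta s)"
proof -
  define H where "H = (\<lambda>m. {s. Re s > 1 - real m})"
  have "\<forall>m. \<exists>F. F holomorphic_on H m \<and> (\<forall>s. Re s > 1 \<longrightarrow> F s = (s - 1) * dirichlet_zeta s)"
    unfolding H_def by (intro allI zeta_halfplane_continuation)
  from choice[OF this] obtain F where F: "\<And>m. F m holomorphic_on H m"
    "\<And>m s. Re s > 1 \<Longrightarrow> F m s = (s - 1) * dirichlet_zeta s" by blast
  have eq: "F m s = F n s" if mn: "m \<le> n" and s: "s \<in> H m" for m n s
  proof (rule analytic_continuation_open[of "{s. Re s > 1}" "H m" "F m" "F n"])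
    show "open {s. Re s > 1}" "open (H m)" by (simp_all add: H_def open_halfspace_Re_gt)
    have "(2::complex) \<in> {s. Re s > 1}" by simp
    then show "{s. Re s > 1} \<noteq> {}" by blast
    show "connected (H m)" by (simp add: H_def convex_connected convex_halfspace_Re_gt)
    show "{s. Re s > 1} \<subseteq> H m" by (auto simp: H_def)
    show "F n holomorphic_on H m"
      using F(1)[of n] by (rule holomorphic_on_subset) (use mn in \<open>auto simp: H_def\<close>)
  qed (use F s in auto)
  \<comment> \<open>The least index merely selects one of the agreeing continuations;
    \<open>G\<close> coincides with every \<open>F m\<close> on \<open>H m\<close>.\<close>
  define G where "G = (\<lambda>s. F (LEAST m. s \<in> H m) s)"
  have G: "G s = F m s" if "s \<in> H m" for m s
    unfolding G_def using that by (intro eq Least_le LeastI[of "\<lambda>m. s \<in> H m"])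
  have "G holomorphic_on (\<Union>m\<in>UNIV. H m)"
  proof (rule holomorphic_on_UN_open)
    show "G holomorphic_on H m" for m
      using F(1)[of m] by (rule holomorphic_transform) (simp add: G)
    show "open (H m)" for m by (simp add: H_def open_halfspace_Re_gt)
  qed
  moreover have "(\<Union>m\<in>UNIV. H m) = UNIV"
  proof (intro equalityI subsetI)
    fix s :: complex
    obtain m where "1 - Re s < real m" using reals_Archimedean2 by blast
    then show "s \<in> (\<Union>m\<in>UNIV. H m)" by (auto simp: H_def intro!: exI[of _ m])
  qed simp
  moreover have "G s = (s - 1) * dirichlet_zeta s" if "Re s > 1" for s
    using G[of s 0] F(2)[OF that] that by (simp add: H_def)
  ultimately have "G holomorphic_on UNIV" "\<forall>s. Re s > 1 \<longrightarrow> G s = (s - 1) * dirichlet_zeta s"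
    by simp_all
  then show ?thesis by blast
qed

lemma inverse_powr_sums_dirichlet_zeta:
  "Re s > 1 \<Longrightarrow> (\<lambda>n. 1 / of_nat (Suc n) powr s) sums dirichlet_zeta s"
  using dirichlet_zeta_sums[of s] by (simp only: powr_minus_divide)

text \<open>Existence: divide the entire continuation of \<open>(s - 1) * dirichlet_zeta s\<close>
  by \<open>s - 1\<close>. Uniqueness: the identity theorem on the connected punctured plane, the
  value at 1 being prescribed. Together they make the definite description denote.\<close>

lemma holomorphic_riemann_zeta: "riemann_zeta holomorphic_on (- {1})"
proof -
  obtain F where F: "F holomorphic_on UNIV" and F_eq: "\<forall>s. Re s > 1 \<longrightarrow> F s = (s - 1) * dirichlet_zeta s"
    using zeta_entire_continuation by (elim exE conjE)
  define Z where "Z = (\<lambda>s. F s / (s - 1))"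
  have Z_hol: "Z holomorphic_on - {1}"
    unfolding Z_def by (intro holomorphic_intros holomorphic_on_subset[OF F]) auto
  have Z_eq: "Z s = dirichlet_zeta s" if "Re s > 1" for s
  proof -
    have "s \<noteq> 1" using that by auto
    with that F_eq show ?thesis by (simp add: Z_def)
  qed
  have "riemann_zeta = Z"
    unfolding riemann_zeta_def
  proof (rule the_equality, intro conjI allI impI)
    show "(\<lambda>n. 1 / of_nat (Suc n) powr s) sums Z s" if "Re s > 1" for s
      unfolding Z_eq[OF that] by (rule inverse_powr_sums_dirichlet_zeta[OF that])
    \<comment> \<open>Division by zero yields 0, in agreement with the normalisation at the
      pole.\<close>
    show "Z 1 = 0" by (simp add: Z_def)
  next
    fix f :: "complex \<Rightarrow> complex"
    assume "f holomorphic_on - {1} \<and>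
      (\<forall>s. Re s > 1 \<longrightarrow> (\<lambda>n. 1 / of_nat (Suc n) powr s) sums f s) \<and> f 1 = 0"
    then have f: "f holomorphic_on - {1}"
      "\<forall>s. Re s > 1 \<longrightarrow> (\<lambda>n. 1 / of_nat (Suc n) powr s) sums f s" "f 1 = 0"
      by simp_all
    show "f = Z"
    proof
      fix s
      show "f s = Z s"
      proof (cases "s = 1")
        case True
        then show ?thesis using f(3) by (simp add: Z_def)
      next
        case False
        show ?thesis
        proof (rule analytic_continuation_open[of "{s. Re s > 1}" "- {1}" f Z])
          show "open {s. Re s > 1}" by (rule open_halfspace_Re_gt)
          have "(2::complex) \<in> {s. Re s > 1}" by simp
          then show "{s. Re s > 1} \<noteq> {}" by blast
          show "connected (- {1::complex})" by (rule connected_punctured_universe) simp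
          fix s assume "s \<in> {s. Re s > 1}"
          then have s: "Re s > 1" by simp
          show "f s = Z s"
            unfolding Z_eq[OF s]
            by (rule sums_unique2[OF f(2)[rule_format, OF s] inverse_powr_sums_dirichlet_zeta[OF s]])
        qed (use False f(1) Z_hol in auto)
      qed
    qed
  qed (rule Z_hol)
  with Z_hol show ?thesis by simp
qed

section \<open>Continuity on the critical line\<close>

lemma critical_line_neq_1: "1 / 2 + \<i> * of_real t \<noteq> 1"
proof
  assume "1 / 2 + \<i> * of_real t = 1"
  from arg_cong[where f = Re, OF this] show False by simp
qed

lemma continuous_on_zeta_crit: "continuous_on A zeta_crit"
  unfolding zeta_crit_def[abs_def]
proof (rule continuous_on_compose2[OF holomorphic_on_imp_continuous_on[OF holomorphic_riemann_zeta]])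
  show "continuous_on A (\<lambda>t. 1 / 2 + \<i> * of_real t)" by (intro continuous_intros)
  show "(\<lambda>t. 1 / 2 + \<i> * of_real t) ` A \<subseteq> - {1}"
    by (rule image_subsetI)
       (simp only: Compl_iff singleton_iff critical_line_neq_1 not_False_eq_True)
qed

section \<open>Iterates of a ladder and of its inverse\<close>

text \<open>\<open>ln (f t) = ln t + ln (f t / t)\<close>, where the last term tends to 0 while
  \<open>ln t\<close> tends to infinity.\<close>

lemma ln_asymp_equiv_ln:
  fixes f :: "real \<Rightarrow> real"
  assumes "f \<sim>[at_top] (\<lambda>t. t)"
  shows "(\<lambda>t. ln (f t)) \<sim>[at_top] ln"
proof -
  have pos: "\<forall>\<^sub>F t in at_top. f t > 0"
    using asymp_equiv_eventually_pos_iff[OF assms] eventually_gt_at_top[of 0]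
    by eventually_elim simp
  have "((\<lambda>t. f t / t) \<longlongrightarrow> 1) at_top"
    by (rule asymp_equivD_strong[OF assms]) (use eventually_gt_at_top[of 0] in eventually_elim, simp)
  then have "((\<lambda>t. ln (f t / t)) \<longlongrightarrow> ln 1) at_top"
    by (rule tendsto_ln) simp
  then have "((\<lambda>t. ln (f t / t) / ln t) \<longlongrightarrow> 0) at_top"
    by (rule tendsto_divide_0) (simp add: filterlim_at_top_imp_at_infinity ln_at_top)
  then have "((\<lambda>t. 1 + ln (f t / t) / ln t) \<longlongrightarrow> 1 + 0) at_top"
    by (intro tendsto_add tendsto_const)
  moreover have "\<forall>\<^sub>F t in at_top. 1 + ln (f t / t) / ln t = ln (f t) / ln t"
    using pos eventually_gt_at_top[of 1] by eventually_elim (simp add: ln_div field_simps)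
  ultimately have "((\<lambda>t. ln (f t) / ln t) \<longlongrightarrow> 1) at_top"
    by (simp add: tendsto_cong)
  then show ?thesis by (rule asymp_equivI')
qed

lemma asymp_equiv_id_imp_at_top:
  fixes f :: "real \<Rightarrow> real"
  assumes "f \<sim>[at_top] (\<lambda>t. t)"
  shows "filterlim f at_top at_top"
  using asymp_equiv_at_top_transfer[OF asymp_equiv_symI[OF assms]] by (simp add: filterlim_ident)

lemma funpow_asymp_equiv_id:
  fixes f :: "real \<Rightarrow> real"
  assumes "f \<sim>[at_top] (\<lambda>t. t)"
  shows "(f ^^ r) \<sim>[at_top] (\<lambda>t. t)"
proof (induction r)
  case 0
  show ?case by (simp add: id_def)
next
  case (Suc r)
  have "(\<lambda>t. f ((f ^^ r) t)) \<sim>[at_top] (\<lambda>t. (f ^^ r) t)"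
    by (rule asymp_equiv_compose'[OF assms asymp_equiv_id_imp_at_top[OF Suc]])
  with Suc have "(\<lambda>t. f ((f ^^ r) t)) \<sim>[at_top] (\<lambda>t. t)"
    by (blast intro: asymp_equiv_trans)
  then show ?case by (simp add: o_def)
qed

text \<open>Every factor is asymptotic to \<open>ln t\<close>, since all iterates are asymptotic to
  the identity. The result is expressed through \<open>(f ^^ k) t\<close> because this is the
  quantity that the limits of integration control.\<close>

lemma prod_along_iterates_asymp_equiv:
  fixes f \<omega> :: "real \<Rightarrow> real"
  assumes f: "f \<sim>[at_top] (\<lambda>t. t)" and \<omega>: "\<omega> \<sim>[at_top] ln"
  shows "(\<lambda>t. \<Prod>r<k. \<omega> ((f ^^ r) t)) \<sim>[at_top] (\<lambda>t. ln ((f ^^ k) t) ^ k)"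
proof -
  have ln: "(\<lambda>t. ln ((f ^^ r) t)) \<sim>[at_top] ln" for r
    by (intro ln_asymp_equiv_ln funpow_asymp_equiv_id f)
  have "(\<lambda>t. \<omega> ((f ^^ r) t)) \<sim>[at_top] ln" for r
    using asymp_equiv_compose'[OF \<omega> asymp_equiv_id_imp_at_top[OF funpow_asymp_equiv_id[OF f]]] ln
    by (rule asymp_equiv_trans)
  then have "(\<lambda>t. \<Prod>r<k. \<omega> ((f ^^ r) t)) \<sim>[at_top] (\<lambda>t. ln t ^ k)"
    by (induction k) (auto intro!: asymp_equiv_mult simp: power_Suc2 simp del: power_Suc)
  moreover have "(\<lambda>t. ln ((f ^^ k) t) ^ k) \<sim>[at_top] (\<lambda>t. ln t ^ k)"
    by (intro asymp_equiv_power ln)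
  ultimately show ?thesis
    by (rule asymp_equiv_trans[OF _ asymp_equiv_symI])
qed

section \<open>Reverse iterations\<close>

text \<open>The intermediate value theorem gives every large \<open>X\<close> a preimage, and strict
  monotonicity keeps the preimage chosen by \<open>inv_into\<close> from being small.\<close>

lemma inv_into_at_top:
  fixes f :: "real \<Rightarrow> real"
  assumes mono: "strict_mono_on {T0..} f" and lim: "filterlim f at_top at_top"
    and cont: "\<forall>\<^sub>F t in at_top. isCont f t"
  shows "filterlim (inv_into {T0..} f) at_top at_top"
    and "\<forall>\<^sub>F X in at_top. f (inv_into {T0..} f X) = X"
proof -
  obtain A where A: "\<And>t. t \<ge> A \<Longrightarrow> isCont f t"
    using cont by (auto simp: eventually_at_top_linorder)
  \<comment> \<open>The bound \<open>B\<close> stays variable: \<open>B = max A T0\<close> gives the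
    inverse property, larger values give divergence.\<close>
  have *: "f (inv_into {T0..} f X) = X \<and> B \<le> inv_into {T0..} f X"
    if B: "max A T0 \<le> B" "f B \<le> X" for B X
  proof -
    have "\<forall>\<^sub>F t in at_top. X \<le> f t \<and> B \<le> t"
      using lim eventually_ge_at_top by (auto simp: filterlim_at_top intro: eventually_conj)
    then obtain C where C: "X \<le> f C" "B \<le> C"
      using eventually_happens'[OF trivial_limit_at_top_linorder] by blast
    have "\<exists>t. B \<le> t \<and> t \<le> C \<and> f t = X"
      using B C A by (intro IVT) auto
    then have X: "X \<in> f ` {T0..}" using B by auto
    have "f (inv_into {T0..} f X) = X" using X by (rule f_inv_into_f)
    moreover have "inv_into {T0..} f X \<in> {T0..}" using X by (rule inv_into_into)
    moreover have "B \<le> inv_into {T0..} f X"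
    proof (rule ccontr)
      assume "\<not> ?thesis"
      then have "f (inv_into {T0..} f X) < f B"
        using calculation(2) B by (intro strict_mono_onD[OF mono]) auto
      with calculation(1) B show False by simp
    qed
    ultimately show ?thesis by blast
  qed
  show "\<forall>\<^sub>F X in at_top. f (inv_into {T0..} f X) = X"
    using eventually_ge_at_top[of "f (max A T0)"] by eventually_elim (use * in blast)
  show "filterlim (inv_into {T0..} f) at_top at_top"
    unfolding filterlim_at_top
  proof
    fix Z
    show "\<forall>\<^sub>F X in at_top. Z \<le> inv_into {T0..} f X"
      using eventually_ge_at_top[of "f (max (max A T0) Z)"]
      by eventually_elim (use *[of "max (max A T0) Z"] in auto)
  qed
qed

lemma filterlim_funpow:
  assumes "filterlim g F F"
  shows "filterlim (g ^^ k) F F"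
proof (induction k)
  case 0
  show ?case by (simp add: id_def filterlim_ident)
next
  case (Suc k)
  then show ?case using filterlim_compose[OF assms Suc] by (simp add: o_def)
qed

text \<open>The innermost pair in \<open>f (g ((g ^^ k) X))\<close> cancels, since
  \<open>g ^^ k\<close> preserves the filter along which \<open>f\<close> inverts
  \<open>g\<close>.\<close>

lemma eventually_funpow_inverse:
  assumes "filterlim g F F" "\<forall>\<^sub>F X in F. f (g X) = X"
  shows "\<forall>\<^sub>F X in F. (f ^^ k) ((g ^^ k) X) = X"
proof (induction k)
  case (Suc k)
  have "\<forall>\<^sub>F X in F. f (g ((g ^^ k) X)) = (g ^^ k) X"
    using assms(2) filterlim_funpow[OF assms(1)] by (rule eventually_compose_filterlim)
  with Suc show ?case
    by eventually_elim (simp add: funpow_swap1)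
qed simp

section \<open>Derivatives of iterates and comparison of integrals\<close>

lemma funpow_has_real_derivative:
  fixes f d :: "real \<Rightarrow> real"
  assumes "\<And>r. r < k \<Longrightarrow> (f has_real_derivative d ((f ^^ r) t)) (at ((f ^^ r) t))"
  shows "((f ^^ k) has_real_derivative (\<Prod>r<k. d ((f ^^ r) t))) (at t)"
  using assms
proof (induction k)
  case 0
  show ?case by (simp add: id_def)
next
  case (Suc k)
  from Suc have "((f ^^ k) has_real_derivative (\<Prod>r<k. d ((f ^^ r) t))) (at t)" by simp
  then have "(f \<circ> (f ^^ k) has_real_derivative d ((f ^^ k) t) * (\<Prod>r<k. d ((f ^^ r) t))) (at t)"
    by (intro DERIV_chain Suc.prems) auto
  then show ?case by (simp only: funpow.simps prod.lessThan_Suc mult.commute)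
qed

text \<open>The fundamental theorem of calculus makes \<open>D\<close> integrable as a derivative,
  whatever its regularity, and evaluates its integral; comparison with \<open>P\<close> gives both
  bounds.\<close>

lemma integral_between_multiples_of_derivative:
  fixes h D P :: "real \<Rightarrow> real"
  assumes "a \<le> b" "P integrable_on {a..b}"
    and deriv: "\<And>t. t \<in> {a..b} \<Longrightarrow> (h has_real_derivative D t) (at t)"
    and P: "\<And>t. t \<in> {a..b} \<Longrightarrow> m * D t \<le> P t \<and> P t \<le> M * D t"
  shows "m * (h b - h a) \<le> integral {a..b} P" "integral {a..b} P \<le> M * (h b - h a)"
proof -
  have D: "(D has_integral (h b - h a)) {a..b}"
    using assms(1) deriv
    by (intro fundamental_theorem_of_calculus)
       (auto simp: has_real_derivative_iff_has_vector_derivative[symmetric] intro: has_field_derivative_at_within)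
  note int = integrable_integral[OF assms(2)]
  show "m * (h b - h a) \<le> integral {a..b} P"
    by (rule has_integral_le[OF has_integral_mult_right[OF D] int]) (use P in auto)
  show "integral {a..b} P \<le> M * (h b - h a)"
    by (rule has_integral_le[OF int has_integral_mult_right[OF D]]) (use P in auto)
qed

section \<open>The integral between reverse iterates\<close>

text \<open>Apart from the derivative formula, zeta enters only through the continuity and
  nonnegativity of its squared modulus; \<open>w\<close> stands for that function.\<close>

lemma reverse_iter_integral_asymp_equiv:
  fixes f w \<omega> \<Omega> :: "real \<Rightarrow> real"
  assumes mono: "strict_mono_on {T0..} f"
    and f: "f \<sim>[at_top] (\<lambda>t. t)"
    and deriv: "\<forall>\<^sub>F t in at_top. (f has_real_derivative w t / \<omega> t) (at t)"
    and \<omega>: "\<omega> \<sim>[at_top] ln"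
    and w: "continuous_on UNIV w" "\<And>t. w t \<ge> 0"
    and \<Omega>_pos: "\<forall>\<^sub>F T in at_top. 0 < \<Omega> T"
    and \<Omega>: "(\<lambda>T. \<Omega> T / ln T ^ k) \<in> o[at_top](\<lambda>T. T)"
  shows "(\<lambda>T. integral {reverse_iter T0 f k T .. reverse_iter T0 f k (T + \<Omega> T / ln T ^ k)}
           (\<lambda>t. \<Prod>r<k. w ((f ^^ r) t))) \<sim>[at_top] \<Omega>"
proof -
  define U where "U = (\<lambda>T. T + \<Omega> T / ln T ^ k)"
  define a where "a = (\<lambda>X. reverse_iter T0 f k X)"
  define W where "W = (\<lambda>t. \<Prod>r<k. \<omega> ((f ^^ r) t))"
  define P where "P = (\<lambda>t. \<Prod>r<k. w ((f ^^ r) t))"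
  define I where "I = (\<lambda>T. integral {a T..a (U T)} P)"
  have f_lim: "filterlim f at_top at_top" by (rule asymp_equiv_id_imp_at_top[OF f])
  have "\<forall>\<^sub>F t in at_top. isCont f t"
    using deriv by eventually_elim (rule DERIV_isCont)
  note inv = inv_into_at_top[OF mono f_lim this]
  have a_lim: "filterlim a at_top at_top"
    using filterlim_funpow[OF inv(1)] by (simp add: a_def reverse_iter_def[abs_def])
  have fa: "\<forall>\<^sub>F X in at_top. (f ^^ k) (a X) = X"
    using eventually_funpow_inverse[OF inv] by (simp add: a_def reverse_iter_def)
  \<comment> \<open>The increment is \<open>o(T)\<close> by assumption, which makes the logarithms
    at both ends of the range equivalent.\<close>
  have U: "U \<sim>[at_top] (\<lambda>T. T)"
    using \<Omega> by (simp add: U_def asymp_equiv_altdef)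
  have U_lim: "filterlim U at_top at_top" by (rule asymp_equiv_id_imp_at_top[OF U])
  have "(\<lambda>T. ln (U T) ^ k) \<sim>[at_top] (\<lambda>T. ln T ^ k)"
    by (intro asymp_equiv_power ln_asymp_equiv_ln U)
  then have q: "((\<lambda>T. ln (U T) ^ k / ln T ^ k) \<longlongrightarrow> 1) at_top"
    by (rule asymp_equivD_strong) (use eventually_gt_at_top[of 1] in eventually_elim, simp)

  have W_asymp: "W \<sim>[at_top] (\<lambda>t. ln ((f ^^ k) t) ^ k)"
    unfolding W_def by (rule prod_along_iterates_asymp_equiv[OF f \<omega>])
  have iter_lim: "filterlim (f ^^ r) at_top at_top" for r by (rule filterlim_funpow[OF f_lim])
  have ln_iter_pos: "\<forall>\<^sub>F t in at_top. ln ((f ^^ k) t) > 0"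
    using eventually_compose_filterlim[OF eventually_gt_at_top[of 1] iter_lim[of k]]
    by eventually_elim simp
  have W_lim: "((\<lambda>t. W t / ln ((f ^^ k) t) ^ k) \<longlongrightarrow> 1) at_top"
    by (rule asymp_equivD_strong[OF W_asymp]) (use ln_iter_pos in eventually_elim, simp)
  have \<omega>_pos: "\<forall>\<^sub>F t in at_top. \<omega> t > 0"
    using asymp_equiv_eventually_pos_iff[OF \<omega>] eventually_gt_at_top[of 1] by eventually_elim simp

  \<comment> \<open>The two sides differ because \<open>(f ^^ k) t\<close> starts at
    \<open>T\<close>, giving exactly \<open>ln T ^ k\<close> below, but ends at \<open>U T\<close>,
    giving \<open>ln (U T) ^ k\<close> above.\<close>
  have bounds: "\<forall>\<^sub>F T in at_top. 1 - \<delta> \<le> I T / \<Omega> T \<and> I T / \<Omega> T \<le> (1 + \<delta>) * (ln (U T) ^ k / ln T ^ k)"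
    if \<delta>: "0 < \<delta>" "\<delta> < 1" for \<delta>
  proof -
    have iter: "\<forall>\<^sub>F t in at_top. \<forall>r\<in>{..<k}. \<omega> ((f ^^ r) t) > 0 \<and>
        (f has_real_derivative w ((f ^^ r) t) / \<omega> ((f ^^ r) t)) (at ((f ^^ r) t))"
      using eventually_compose_filterlim[OF eventually_conj[OF \<omega>_pos deriv] iter_lim]
      by (subst eventually_ball_finite_distrib) auto
    have "\<forall>\<^sub>F t in at_top. 1 - \<delta> < W t / ln ((f ^^ k) t) ^ k" "\<forall>\<^sub>F t in at_top. W t / ln ((f ^^ k) t) ^ k < 1 + \<delta>"
      using order_tendstoD[OF W_lim] \<delta> by auto
    with iter ln_iter_pos have "\<forall>\<^sub>F t in at_top. (\<forall>r\<in>{..<k}. \<omega> ((f ^^ r) t) > 0 \<and>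
        (f has_real_derivative w ((f ^^ r) t) / \<omega> ((f ^^ r) t)) (at ((f ^^ r) t))) \<and>
        (1 - \<delta>) * ln ((f ^^ k) t) ^ k \<le> W t \<and> W t \<le> (1 + \<delta>) * ln ((f ^^ k) t) ^ k"
      by eventually_elim (auto simp: field_simps)
    then obtain B where B: "\<And>t r. t \<ge> B \<Longrightarrow> r < k \<Longrightarrow> \<omega> ((f ^^ r) t) > 0"
      "\<And>t r. t \<ge> B \<Longrightarrow> r < k \<Longrightarrow> (f has_real_derivative w ((f ^^ r) t) / \<omega> ((f ^^ r) t)) (at ((f ^^ r) t))"
      "\<And>t. t \<ge> B \<Longrightarrow> (1 - \<delta>) * ln ((f ^^ k) t) ^ k \<le> W t"
      "\<And>t. t \<ge> B \<Longrightarrow> W t \<le> (1 + \<delta>) * ln ((f ^^ k) t) ^ k"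
      unfolding eventually_at_top_linorder by (metis lessThan_iff)
    have W_pos: "W t > 0" if "t \<ge> B" for t
      unfolding W_def using B(1)[OF that] by (intro prod_pos) auto
    have P_nonneg: "P t \<ge> 0" for t
      unfolding P_def by (intro prod_nonneg w(2))
    have D: "((f ^^ k) has_real_derivative P t / W t) (at t)" if "t \<ge> B" for t
      using funpow_has_real_derivative[of k f "\<lambda>t. w t / \<omega> t" t] B(2)[OF that]
      by (simp add: P_def W_def prod_dividef)
    have iter_cont: "isCont (f ^^ r) t" if "t \<ge> B" "r < k" for t r
      using funpow_has_real_derivative[of r f "\<lambda>t. w t / \<omega> t" t] B(2)[OF that(1)] that(2)
      by (intro DERIV_isCont) auto
    \<comment> \<open>The derivative \<open>P t / W t\<close> vanishes at zeros of \<open>P\<close>,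
      but its sign suffices for weak monotonicity.\<close>
    have iter_mono: "(f ^^ k) s \<le> (f ^^ k) t" if "B \<le> s" "s \<le> t" for s t
      by (rule DERIV_nonneg_imp_nondecreasing[OF that(2)])
         (use D that W_pos P_nonneg in \<open>meson divide_nonneg_pos order_trans\<close>)
    have P_cont: "continuous_on {s..t} P" if "B \<le> s" for s t
      unfolding P_def
      by (intro continuous_intros continuous_on_compose2[OF w(1)] continuous_at_imp_continuous_on ballI iter_cont)
         (use that in auto)
    have "\<forall>\<^sub>F T in at_top. B \<le> a T" "\<forall>\<^sub>F T in at_top. B \<le> a (U T)"
      using a_lim filterlim_compose[OF a_lim U_lim] by (auto simp: filterlim_at_top)
    moreover have "\<forall>\<^sub>F T in at_top. (f ^^ k) (a (U T)) = U T"
      by (rule eventually_compose_filterlim[OF fa U_lim])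
    ultimately show ?thesis
      using fa \<Omega>_pos eventually_gt_at_top[of 1]
    proof eventually_elim
      case (elim T)
      have L: "ln T > 0" using elim by simp
      have UT: "U T - T = \<Omega> T / ln T ^ k" by (simp add: U_def)
      have "\<Omega> T / ln T ^ k > 0" using elim L by simp
      with UT have TU: "T < U T" by simp
      \<comment> \<open>If the limits of integration were reversed, monotonicity of
        \<open>f ^^ k\<close> would give \<open>U T \<le> T\<close>.\<close>
      have le: "a T \<le> a (U T)"
        using iter_mono[of "a (U T)" "a T"] elim TU by (cases "a T \<le> a (U T)") auto
      have t: "(1 - \<delta>) * ln T ^ k * (P t / W t) \<le> P t \<and> P t \<le> (1 + \<delta>) * ln (U T) ^ k * (P t / W t)"
        if "t \<in> {a T..a (U T)}" for t
      proof -
        have tB: "B \<le> t" using that elim by simp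
        have ft: "T \<le> (f ^^ k) t" "(f ^^ k) t \<le> U T"
          using iter_mono[of "a T" t] iter_mono[of t "a (U T)"] that elim tB by auto
        have "ln T ^ k \<le> ln ((f ^^ k) t) ^ k" "ln ((f ^^ k) t) ^ k \<le> ln (U T) ^ k"
          using ft elim by (auto intro!: power_mono)
        then have "(1 - \<delta>) * ln T ^ k \<le> W t" "W t \<le> (1 + \<delta>) * ln (U T) ^ k"
          using \<delta>
          by (auto intro!: order_trans[OF mult_left_mono B(3)[OF tB]] order_trans[OF B(4)[OF tB] mult_left_mono])
        \<comment> \<open>Multiplication by the derivative \<open>P t / W t\<close> turns the bounds
          on \<open>W\<close> into bounds on \<open>P\<close> by multiples of that
          derivative.\<close>
        then have "(1 - \<delta>) * ln T ^ k * (P t / W t) \<le> W t * (P t / W t)"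
          "W t * (P t / W t) \<le> (1 + \<delta>) * ln (U T) ^ k * (P t / W t)"
          by - (intro mult_right_mono divide_nonneg_pos P_nonneg W_pos tB; assumption)+
        then show ?thesis using W_pos[OF tB] by simp
      qed
      have int: "P integrable_on {a T..a (U T)}"
        using elim by (intro integrable_continuous_real P_cont)
      have D': "((f ^^ k) has_real_derivative P t / W t) (at t)" if "t \<in> {a T..a (U T)}" for t
        using that elim by (intro D) auto
      note I = integral_between_multiples_of_derivative[OF le int D' t, folded I_def]
      \<comment> \<open>Between the limits \<open>f ^^ k\<close> rises by
        \<open>\<Omega> T / ln T ^ k\<close>, so \<open>ln T ^ k\<close> cancels in the lower
        bound.\<close>
      have "(1 - \<delta>) * \<Omega> T \<le> I T" "I T \<le> (1 + \<delta>) * (ln (U T) ^ k / ln T ^ k) * \<Omega> T"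
        using I elim L by (simp_all add: UT I_def)
      then show ?case using elim by (simp add: pos_le_divide_eq pos_divide_le_eq)
    qed
  qed

  have "((\<lambda>T. I T / \<Omega> T) \<longlongrightarrow> 1) at_top"
  proof (rule tendstoI)
    fix e :: real assume e: "e > 0"
    \<comment> \<open>The upper bound becomes \<open>(1 + \<delta>) * (1 + \<delta>)\<close>, which
      is below \<open>1 + 4 * \<delta>\<close> for \<open>0 < \<delta> < 2\<close>; hence
      \<open>e / 4\<close>.\<close>
    define \<delta> where "\<delta> = min (1 / 2) (e / 4)"
    have \<delta>: "0 < \<delta>" "\<delta> < 1" "4 * \<delta> \<le> e" using e by (auto simp: \<delta>_def)
    have "\<forall>\<^sub>F T in at_top. ln (U T) ^ k / ln T ^ k < 1 + \<delta>"
      using order_tendstoD(2)[OF q] \<delta> by auto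
    with bounds[OF \<delta>(1,2)] show "\<forall>\<^sub>F T in at_top. dist (I T / \<Omega> T) 1 < e"
    proof eventually_elim
      case (elim T)
      have "(1 + \<delta>) * (ln (U T) ^ k / ln T ^ k) \<le> (1 + \<delta>) * (1 + \<delta>)"
        using elim \<delta> by (intro mult_left_mono) auto
      also have "\<dots> < 1 + 4 * \<delta>" using \<delta> by (simp add: algebra_simps)
      finally show ?case using elim \<delta> by (auto simp: dist_real_def)
    qed
  qed
  then have "I \<sim>[at_top] \<Omega>" by (rule asymp_equivI')
  then show ?thesis by (simp add: I_def a_def U_def P_def)
qed

section \<open>From the stated asymptotics to the required form\<close>

lemma asymp_equiv_id_of_diff_bigo:
  fixes f :: "real \<Rightarrow> real"
  assumes "(\<lambda>T. T - f T) \<in> O[at_top](\<lambda>T. T / ln T)"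
  shows "f \<sim>[at_top] (\<lambda>t. t)"
proof -
  have "(\<lambda>T::real. T / ln T) \<in> o[at_top](\<lambda>T. T)"
  proof (rule smalloI_tendsto)
    have "((\<lambda>T::real. inverse (ln T)) \<longlongrightarrow> 0) at_top"
      by (rule tendsto_inverse_0_at_top[OF ln_at_top])
    moreover have "\<forall>\<^sub>F T::real in at_top. inverse (ln T) = T / ln T / T"
      using eventually_gt_at_top[of 1] by eventually_elim (simp add: field_simps)
    ultimately show "((\<lambda>T::real. T / ln T / T) \<longlongrightarrow> 0) at_top" by (simp add: tendsto_cong)
  qed (use eventually_gt_at_top[of 0] in eventually_elim, simp)
  with assms have "(\<lambda>T. T - f T) \<in> o[at_top](\<lambda>T. T)"
    by (rule landau_o.big_small_trans)
  then have "(\<lambda>T. f T - T) \<in> o[at_top](\<lambda>T. T)"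
    by (subst landau_o.small.uminus_in_iff[symmetric]) simp
  then show ?thesis by (simp add: asymp_equiv_altdef)
qed

text \<open>The relative error tends to 0, being of the order of \<open>ln x / x\<close> at
  \<open>x = ln t\<close>.\<close>

lemma asymp_equiv_ln_of_relative_error:
  fixes \<omega> :: "real \<Rightarrow> real"
  assumes "(\<lambda>t. \<omega> t / ln t - 1) \<in> O[at_top](\<lambda>t. ln (ln t) / ln t)"
  shows "\<omega> \<sim>[at_top] ln"
proof -
  have "((\<lambda>t::real. ln (ln t) / ln t) \<longlongrightarrow> 0) at_top"
    by (rule filterlim_compose[OF ln_x_over_x_tendsto_0 ln_at_top])
  then have "(\<lambda>t::real. ln (ln t) / ln t) \<in> o[at_top](\<lambda>_. 1)"
    by (intro smalloI_tendsto) auto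
  with assms have "(\<lambda>t. \<omega> t / ln t - 1) \<in> o[at_top](\<lambda>_. 1)"
    by (rule landau_o.big_small_trans)
  then have "((\<lambda>t. \<omega> t / ln t - 1) \<longlongrightarrow> 0) at_top" by (auto dest: smalloD_tendsto)
  then have "((\<lambda>t. \<omega> t / ln t) \<longlongrightarrow> 1) at_top" by (rule LIM_zero_cancel)
  then show ?thesis by (rule asymp_equivI')
qed

text \<open>One further division by \<open>ln T\<close> only helps; \<open>k \<ge> 1\<close> makes
  the natural subtraction exact, so that \<open>ln T ^ k = ln T * ln T ^ (k - 1)\<close>.\<close>

lemma divide_ln_power_smallo:
  fixes \<Omega> :: "real \<Rightarrow> real"
  assumes "\<Omega> \<in> o[at_top](\<lambda>T. T * ln T ^ (k - 1))" "k \<ge> 1"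
  shows "(\<lambda>T. \<Omega> T / ln T ^ k) \<in> o[at_top](\<lambda>T. T)"
proof (rule smalloI_tendsto)
  have "((\<lambda>T. \<Omega> T / (T * ln T ^ (k - 1))) \<longlongrightarrow> 0) at_top"
    by (rule smalloD_tendsto[OF assms(1)])
  then have "((\<lambda>T. \<Omega> T / (T * ln T ^ (k - 1)) * inverse (ln T)) \<longlongrightarrow> 0 * 0) at_top"
    by (intro tendsto_mult tendsto_inverse_0_at_top ln_at_top)
  moreover have "\<forall>\<^sub>F T in at_top.
      \<Omega> T / (T * ln T ^ (k - 1)) * inverse (ln T) = \<Omega> T / ln T ^ k / T"
    using eventually_gt_at_top[of 1]
    by eventually_elim (use assms(2) in \<open>simp add: field_simps power_eq_if[of _ k]\<close>)
  ultimately show "((\<lambda>T. \<Omega> T / ln T ^ k / T) \<longlongrightarrow> 0) at_top" by (simp add: tendsto_cong)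
qed (use eventually_gt_at_top[of 0] in eventually_elim, simp)

theorem mainTheorem2:
  fixes \<mu> \<phi> \<omega> \<Omega> :: "real \<Rightarrow> real" and T0 :: real and k0 k :: nat
  assumes "admissible \<mu>"
    and "solves_ladder_eq \<mu> \<phi>"
    and "strict_mono_on {T0..} (ladder1 \<phi>)"
    and "filterlim (ladder1 \<phi>) at_top at_top"
    and "(\<lambda>T. T - ladder1 \<phi> T) \<sim>[at_top] (\<lambda>T. (1 - euler_mascheroni) * prime_counting T)"
    and "prime_counting \<sim>[at_top] (\<lambda>T. T / ln T)"
    and "\<forall>\<^sub>F t in at_top.
           (ladder1 \<phi> has_real_derivative (cmod (zeta_crit t))\<^sup>2 / \<omega> t) (at t)"
    and "(\<lambda>t. \<omega> t / ln t - 1) \<in> O[at_top](\<lambda>t. ln (ln t) / ln t)"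
    and "k \<in> {1..k0}"
    and "\<forall>\<^sub>F T in at_top. 0 < \<Omega> T"
    and "\<Omega> \<in> o[at_top](\<lambda>T. T * ln T ^ (k - 1))"
  shows "(\<lambda>T. integral {reverse_iter T0 (ladder1 \<phi>) k T ..
                         reverse_iter T0 (ladder1 \<phi>) k (T + \<Omega> T / ln T ^ k)}
                 (\<lambda>t. \<Prod>r = 0..k - 1. (cmod (zeta_crit ((ladder1 \<phi> ^^ r) t)))\<^sup>2))
           \<sim>[at_top] \<Omega>"
proof -
  \<comment> \<open>The two asymptotic hypotheses combine to
    \<open>T - ladder1 \<phi> T = O(T / ln T)\<close>, with the constant absorbed.\<close>
  have "(\<lambda>T. (1 - euler_mascheroni) * prime_counting T) \<sim>[at_top]
      (\<lambda>T. (1 - euler_mascheroni) * (T / ln T))"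
    by (intro asymp_equiv_mult asymp_equiv_refl assms(6))
  with assms(5) have "(\<lambda>T. T - ladder1 \<phi> T) \<sim>[at_top] (\<lambda>T. (1 - euler_mascheroni) * (T / ln T))"
    by (rule asymp_equiv_trans)
  then have "(\<lambda>T. T - ladder1 \<phi> T) \<in> O[at_top](\<lambda>T. (1 - euler_mascheroni) * (T / ln T))"
    by (rule asymp_equiv_imp_bigo)
  then have "(\<lambda>T. T - ladder1 \<phi> T) \<in> O[at_top](\<lambda>T. T / ln T)"
    by (rule landau_o.big_trans)
       (auto intro!: bigoI[of _ "\<bar>1 - euler_mascheroni\<bar>"] simp: abs_mult)
  then have f: "ladder1 \<phi> \<sim>[at_top] (\<lambda>t. t)" by (rule asymp_equiv_id_of_diff_bigo)
  \<comment> \<open>As \<open>k \<ge> 1\<close>, the subtraction \<open>k - 1\<close> is exact and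
    the product has exactly \<open>k\<close> factors.\<close>
  have k: "{0..k - 1} = {..<k}" using assms(9) by auto
  have cont: "continuous_on UNIV (\<lambda>t. (cmod (zeta_crit t))\<^sup>2)"
    by (intro continuous_intros continuous_on_zeta_crit)
  have small: "(\<lambda>T. \<Omega> T / ln T ^ k) \<in> o[at_top](\<lambda>T. T)"
    using assms(9) by (intro divide_ln_power_smallo assms(11)) simp
  show ?thesis
    unfolding k
    by (rule reverse_iter_integral_asymp_equiv[OF assms(3) f assms(7)
        asymp_equiv_ln_of_relative_error[OF assms(8)] cont _ assms(10) small]) simp
qed

end
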